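(* Let $p>3$ be a prime and let $n$ be a positive integer. Then $$\frac{a_{pn}-a_n}{(pn)^3}\in\mathbb Z_p.$$
   Context: For each integer $m\ge 0$, define $$a_m:=\sum_{k=0}^m\binom mk\binom{m-k}k\binom{m+k}k,$$ where $\binom{r}{k}=0$ for integers $0\le r<k$. $\mathbb Z_p$ denotes the ring of $p$-adic integers. *)

theory Defs
  imports "HOL-Analysis.Analysis" "HOL-Computational_Algebra.Computational_Algebra"
begin

text \<open>All binomial coefficients below have natural-number arguments; \<open>m - k\<close> does not truncate as
  \<open>k \<le> m\<close>, and \<open>r choose k = 0\<close> whenever \<open>r < k\<close>.\<close>

definition a_seq :: "nat \<Rightarrow> nat" where
  "a_seq m = (\<Sum>k=0..m. (m choose k) * ((m - k) choose k) * ((m + k) choose k))"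

text \<open>The field of \<open>p\<close>-adic numbers is constructed as the completion of the rationals with respect to
  the \<open>p\<close>-adic absolute value (Cauchy sequences modulo null sequences). The ring of \<open>p\<close>-adic
  integers is its closed unit ball. Only the underlying sets are needed, not the ring operations.\<close>

definition padic_abs :: "nat \<Rightarrow> rat \<Rightarrow> real" where
  "padic_abs p r =
     (if r = 0 then 0
      else real p powi (int (multiplicity (int p) (snd (quotient_of r)))
                        - int (multiplicity (int p) (fst (quotient_of r)))))"

definition padic_Cauchy :: "nat \<Rightarrow> (nat \<Rightarrow> rat) \<Rightarrow> bool" where
  "padic_Cauchy p X \<longleftrightarrow>
     (\<forall>e>0. \<exists>N. \<forall>i\<ge>N. \<forall>j\<ge>N. padic_abs p (X i - X j) < e)"

definition padic_rel :: "nat \<Rightarrow> ((nat \<Rightarrow> rat) \<times> (nat \<Rightarrow> rat)) set" where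
  "padic_rel p =
     {(X, Y). padic_Cauchy p X \<and> padic_Cauchy p Y \<and> (\<lambda>i. padic_abs p (X i - Y i)) \<longlonglongrightarrow> 0}"

definition padic_numbers :: "nat \<Rightarrow> (nat \<Rightarrow> rat) set set" where
  "padic_numbers p = {X. padic_Cauchy p X} // padic_rel p"

definition padic_norm :: "nat \<Rightarrow> (nat \<Rightarrow> rat) set \<Rightarrow> real" where
  "padic_norm p C = lim (\<lambda>i. padic_abs p ((SOME X. X \<in> C) i))"

definition padic_ints :: "nat \<Rightarrow> (nat \<Rightarrow> rat) set set" where
  "padic_ints p = {C \<in> padic_numbers p. padic_norm p C \<le> 1}"

definition padic_of_rat :: "nat \<Rightarrow> rat \<Rightarrow> (nat \<Rightarrow> rat) set" where
  "padic_of_rat p r = padic_rel p `` {\<lambda>_. r}"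

lemma padic_abs_divide:
  assumes "prime p" "a \<noteq> 0" "b \<noteq> 0"
  shows "padic_abs p (of_int a / of_int b)
           = real p powi (int (multiplicity (int p) b) - int (multiplicity (int p) a))"
proof -
  obtain c d where q: "quotient_of (of_int a / of_int b) = (c, d)" by fastforce
  have d: "d > 0" using q quotient_of_denom_pos by blast
  have e: "(of_int a / of_int b :: rat) = of_int c / of_int d" using q quotient_of_div by blast
  hence "(of_int (a * d) :: rat) = of_int (c * b)" using d assms by (simp add: field_simps)
  hence eq: "a * d = c * b" by (simp only: of_int_eq_iff)
  have c: "c \<noteq> 0" using eq d assms by auto
  have pr: "prime_elem (int p)" using assms by simp
  have "multiplicity (int p) a + multiplicity (int p) d
          = multiplicity (int p) c + multiplicity (int p) b"
    using arg_cong[OF eq, of "multiplicity (int p)"] pr c d assms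
    by (simp add: prime_elem_multiplicity_mult_distrib)
  hence "int (multiplicity (int p) d) - int (multiplicity (int p) c)
           = int (multiplicity (int p) b) - int (multiplicity (int p) a)" by linarith
  thus ?thesis using q assms by (simp add: padic_abs_def)
qed

lemma padic_abs_nonneg: "padic_abs p r \<ge> 0"
  by (simp add: padic_abs_def)

lemma padic_abs_minus: "padic_abs p (- r) = padic_abs p r"
  by (simp add: padic_abs_def rat_uminus_code Let_def split: prod.splits)

lemma rat_common_denom:
  fixes x y :: rat
  obtains a b d :: int where "d \<noteq> 0" "x = of_int a / of_int d" "y = of_int b / of_int d"
proof -
  obtain a c where 1: "quotient_of x = (a, c)" by fastforce
  obtain b e where 2: "quotient_of y = (b, e)" by fastforce
  have "c > 0" "e > 0" "x = of_int a / of_int c" "y = of_int b / of_int e"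
    using 1 2 quotient_of_denom_pos quotient_of_div by blast+
  thus ?thesis by (intro that[of "c * e" "a * e" "b * c"]) auto
qed

lemma padic_abs_ultra:
  assumes p: "prime p"
  shows "padic_abs p (x + y) \<le> max (padic_abs p x) (padic_abs p y)"
proof (cases "x = 0 \<or> y = 0 \<or> x + y = 0")
  case True
  thus ?thesis using padic_abs_nonneg[of p] by (auto simp: padic_abs_def[of p 0] le_max_iff_disj)
next
  case False
  obtain a b d :: int where d: "d \<noteq> 0" "x = of_int a / of_int d" "y = of_int b / of_int d"
    by (rule rat_common_denom)
  have s: "x + y = of_int (a + b) / of_int d" using d by (simp add: add_divide_distrib)
  have nz: "a \<noteq> 0" "b \<noteq> 0" "a + b \<noteq> 0" using False d s by auto
  let ?m = "multiplicity (int p)"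
  have u: "\<not> is_unit (int p)" using p by (simp add: prime_nat_iff)
  have "int p ^ min (?m a) (?m b) dvd a + b"
    by (intro dvd_add multiplicity_dvd') auto
  hence "min (?m a) (?m b) \<le> ?m (a + b)"
    using nz u by (intro multiplicity_geI) auto
  hence "?m a \<le> ?m (a + b) \<or> ?m b \<le> ?m (a + b)" by auto
  moreover have "real p \<ge> 1" using p prime_ge_1_nat by (simp add: of_nat_le_iff)
  ultimately show ?thesis
    unfolding s unfolding d padic_abs_divide[OF p nz(1) d(1)] padic_abs_divide[OF p nz(2) d(1)]
      padic_abs_divide[OF p nz(3) d(1)] le_max_iff_disj
    by (auto intro: power_int_increasing)
qed

lemma padic_abs_triangle:
  assumes "prime p" shows "padic_abs p (x + y) \<le> padic_abs p x + padic_abs p y"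
  using padic_abs_ultra[OF assms, of x y] padic_abs_nonneg[of p x] padic_abs_nonneg[of p y] by linarith

text \<open>Consistency checks: the construction is a quotient by an equivalence relation, the norm extends
  the absolute value of the rationals, and a rational number is a \<open>p\<close>-adic integer exactly if its
  reduced denominator is prime to \<open>p\<close>.\<close>

lemma equiv_padic_rel:
  assumes p: "prime p" shows "equiv {X. padic_Cauchy p X} (padic_rel p)"
proof (rule equivI)
  show "padic_rel p \<subseteq> {X. padic_Cauchy p X} \<times> {X. padic_Cauchy p X}"
    by (auto simp: padic_rel_def)
  show "refl_on {X. padic_Cauchy p X} (padic_rel p)"
    by (auto simp: padic_rel_def refl_on_def padic_abs_def)
  have "padic_abs p (x - y) = padic_abs p (y - x)" for x y
    using padic_abs_minus[of p "x - y"] by simp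
  thus "sym (padic_rel p)" by (auto simp: padic_rel_def sym_def)
  show "trans (padic_rel p)"
  proof (rule transI)
    fix X Y Z assume *: "(X, Y) \<in> padic_rel p" "(Y, Z) \<in> padic_rel p"
    hence l: "(\<lambda>i. padic_abs p (X i - Y i) + padic_abs p (Y i - Z i)) \<longlonglongrightarrow> 0"
      by (auto simp: padic_rel_def intro: tendsto_add_zero)
    have "norm (padic_abs p (X i - Z i)) \<le> padic_abs p (X i - Y i) + padic_abs p (Y i - Z i)" for i
      using padic_abs_triangle[OF p, of "X i - Y i" "Y i - Z i"] padic_abs_nonneg[of p] by simp
    hence "(\<lambda>i. padic_abs p (X i - Z i)) \<longlonglongrightarrow> 0"
      by (intro Lim_null_comparison[OF _ l] always_eventually) auto
    thus "(X, Z) \<in> padic_rel p" using * by (auto simp: padic_rel_def)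
  qed
qed

lemma padic_Cauchy_const: "padic_Cauchy p (\<lambda>_. r)"
  by (auto simp: padic_Cauchy_def padic_abs_def)

lemma padic_of_rat_in_numbers: "padic_of_rat p r \<in> padic_numbers p"
  by (auto simp: padic_of_rat_def padic_numbers_def padic_Cauchy_const intro: quotientI)

lemma padic_norm_of_rat:
  assumes p: "prime p" shows "padic_norm p (padic_of_rat p r) = padic_abs p r"
proof -
  define X where "X = (SOME X. X \<in> padic_of_rat p r)"
  have "(\<lambda>_. r) \<in> padic_of_rat p r"
    using padic_Cauchy_const by (auto simp: padic_of_rat_def padic_rel_def padic_abs_def)
  hence "X \<in> padic_of_rat p r" unfolding X_def by (rule someI[where P = "\<lambda>X. X \<in> padic_of_rat p r"])
  hence l: "(\<lambda>i. padic_abs p (r - X i)) \<longlonglongrightarrow> 0" by (auto simp: padic_of_rat_def padic_rel_def)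
  have "norm (padic_abs p (X i) - padic_abs p r) \<le> padic_abs p (r - X i)" for i
    using padic_abs_triangle[OF p, of "r - X i" "X i"] padic_abs_triangle[OF p, of "X i - r" r]
      padic_abs_minus[of p "r - X i"] by simp
  hence "(\<lambda>i. padic_abs p (X i) - padic_abs p r) \<longlonglongrightarrow> 0"
    by (intro Lim_null_comparison[OF _ l] always_eventually) auto
  hence "(\<lambda>i. padic_abs p (X i)) \<longlonglongrightarrow> padic_abs p r" by (simp add: LIM_zero_iff)
  thus ?thesis unfolding padic_norm_def X_def[symmetric] by (rule limI)
qed

lemma padic_of_rat_in_ints_iff:
  assumes p: "prime p"
  shows "padic_of_rat p r \<in> padic_ints p \<longleftrightarrow> \<not> int p dvd snd (quotient_of r)"
proof -
  obtain c d where q: "quotient_of r = (c, d)" by fastforce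
  have d: "d > 0" and cop: "coprime c d" using q quotient_of_denom_pos quotient_of_coprime by blast+
  have u: "\<not> is_unit (int p)" using p by (simp add: prime_nat_iff)
  have p1: "real p > 1" using p prime_gt_1_nat by simp
  have "padic_abs p r \<le> 1 \<longleftrightarrow> \<not> int p dvd d"
  proof (cases "r = 0")
    case True
    thus ?thesis using q u by (auto simp: padic_abs_def)
  next
    case False
    have c: "c \<noteq> 0" using False q quotient_of_div[of r c d] by auto
    show ?thesis
    proof (cases "int p dvd d")
      case True
      hence "\<not> int p dvd c" using cop u coprime_common_divisor by blast
      hence "multiplicity (int p) c = 0" by (rule not_dvd_imp_multiplicity_0)
      moreover have "multiplicity (int p) d > 0"
        using True d u by (simp add: multiplicity_gt_zero_iff)
      moreover from this have "real p ^ multiplicity (int p) d > 1"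
        using p1 by (intro one_less_power)
      ultimately show ?thesis using False q True by (simp add: padic_abs_def)
    next
      case nd: False
      hence "multiplicity (int p) d = 0" by (rule not_dvd_imp_multiplicity_0)
      thus ?thesis using False q nd p1
        by (simp add: padic_abs_def power_int_minus inverse_le_1_iff)
    qed
  qed
  thus ?thesis using q by (simp add: padic_ints_def padic_of_rat_in_numbers padic_norm_of_rat[OF p])
qed

end

theory Submission
  imports Defs "HOL-Number_Theory.Number_Theory"
begin

text \<open>
  The summand of \<open>a_seq m\<close> is the multinomial coefficient \<open>(m + k)! / (k!\<^sup>3 (m - 2k)!)\<close>. The same
  coefficients occur in MacMahon's identity
  \<open>\<Sum>i. (n choose i)\<^sup>3 x\<^sup>i y\<^sup>n\<^sup>-\<^sup>i = \<Sum>k. (n + k)! / (k!\<^sup>3 (n - 2k)!) (xy)\<^sup>k (x + y)\<^sup>n\<^sup>-\<^sup>2\<^sup>k\<close>.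
  At the two primitive sixth roots of unity \<open>x\<close> and \<open>y\<close> both \<open>x + y\<close> and \<open>xy\<close> equal \<open>1\<close>, so
  \<open>2 * a_seq n\<close> is the sum of the cubes \<open>(n choose i)\<^sup>3\<close> with the integer weights
  \<open>2 cos (\<pi> (2i - n) / 3)\<close> (\<open>twice_a_seq_eq_sum_cubes\<close>).

  The cubes make the congruence a termwise one. Let \<open>p\<^sup>v\<close> divide \<open>n\<close>. If \<open>p\<close> does not divide \<open>i\<close>,
  then \<open>p\<^sup>v\<^sup>+\<^sup>1\<close> divides \<open>(p * n) choose i\<close>, and its cube vanishes modulo \<open>p\<^sup>3\<^sup>(\<^sup>v\<^sup>+\<^sup>1\<^sup>)\<close>. If
  \<open>i = p * j\<close>, the weight at \<open>i\<close> for \<open>p * n\<close> is the weight at \<open>j\<close> for \<open>n\<close>, because \<open>p\<close> is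
  \<open>\<plusminus> 1\<close> modulo \<open>6\<close>, and the cubes of \<open>(p * n) choose (p * j)\<close> and \<open>n choose j\<close> are congruent
  modulo \<open>p\<^sup>3\<^sup>(\<^sup>v\<^sup>+\<^sup>1\<^sup>)\<close> (\<open>choose_prime_mult_cube_cong\<close>).

  The last point is Jacobsthal's strengthening of Wolstenholme's theorem. The quotient of the two
  binomial coefficients is a quotient of products of integers prime to \<open>p\<close>. These products consist of
  blocks of length \<open>q = p\<^sup>s\<^sup>+\<^sup>1\<close>, where \<open>p\<^sup>s\<close> is the greatest common divisor of \<open>p\<^sup>v\<close> and \<open>j\<close>, and all
  blocks have the same product modulo \<open>q\<^sup>3\<close> (\<open>prod_shifted_totatives_cong\<close>). The powers of \<open>p\<close>
  lost when \<open>s < v\<close> are regained from the divisibility of \<open>n choose j\<close> by \<open>p\<^sup>v\<^sup>-\<^sup>s\<close>.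
\<close>

section \<open>MacMahon's identity at the sixth roots of unity\<close>

text \<open>Vandermonde's identity splits \<open>(x + k) choose (m + l)\<close> into products of \<open>k choose j\<close> with a
  factor free of \<open>k\<close>. After exchanging the sums, the sum over \<open>k\<close> and then the one over \<open>j\<close> are
  again instances of Vandermonde's identity.\<close>

lemma sum_choose_choose_choose_add:
  "(\<Sum>k\<le>l. (m choose k) * (l choose k) * ((x + k) choose (m + l))) = (x choose m) * (x choose l)"
proof -
  have inner: "(\<Sum>k\<le>l. (m choose k) * (l choose k) * (k choose j))
      = (l choose j) * ((m + l - j) choose l)" for j
  proof (cases "j \<le> l")
    case True
    have "(l choose k) * (k choose j) = (l choose j) * ((l - j) choose (l - k))" if "k \<le> l" for k
    proof (cases "j \<le> k")
      case True
      have "(l - j) choose (k - j) = (l - j) choose (l - k)"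
        using binomial_symmetric[of "k - j" "l - j"] True that by simp
      thus ?thesis using choose_mult[OF True that] by simp
    next
      case False
      thus ?thesis using that \<open>j \<le> l\<close> by (simp add: binomial_eq_0)
    qed
    hence "(\<Sum>k\<le>l. (m choose k) * (l choose k) * (k choose j))
        = (\<Sum>k\<le>l. (l choose j) * ((m choose k) * ((l - j) choose (l - k))))"
      by (intro sum.cong) (auto simp: mult.assoc mult.left_commute)
    also have "\<dots> = (l choose j) * ((m + (l - j)) choose l)"
      by (simp only: sum_distrib_left[symmetric] vandermonde)
    finally show ?thesis using True by simp
  next
    case False
    thus ?thesis by (simp add: binomial_eq_0)
  qed
  have outer: "(x choose (m + l - j)) * ((l choose j) * ((m + l - j) choose l))
      = (x choose l) * ((l choose j) * ((x - l) choose (m - j)))" if "j \<le> m" for j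
  proof (cases "m + l - j \<le> x")
    case True
    thus ?thesis using choose_mult[of l "m + l - j" x] that
      by (simp add: algebra_simps)
  next
    case False
    thus ?thesis using that by (cases "l \<le> x") (auto simp: binomial_eq_0)
  qed
  have "(\<Sum>k\<le>l. (m choose k) * (l choose k) * ((x + k) choose (m + l)))
      = (\<Sum>k\<le>l. \<Sum>j\<le>m + l. (x choose (m + l - j)) * ((m choose k) * (l choose k) * (k choose j)))"
    by (intro sum.cong refl)
       (simp add: vandermonde[symmetric] add.commute[of x] sum_distrib_left mult_ac)
  also have "\<dots> = (\<Sum>j\<le>m + l. (x choose (m + l - j)) * ((l choose j) * ((m + l - j) choose l)))"
    by (subst sum.swap) (simp only: sum_distrib_left[symmetric] inner)
  also have "\<dots> = (\<Sum>j\<le>m. (x choose (m + l - j)) * ((l choose j) * ((m + l - j) choose l)))"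
  proof (rule sum.mono_neutral_right)
    show "\<forall>j\<in>{..m + l} - {..m}. (x choose (m + l - j)) * ((l choose j) * ((m + l - j) choose l)) = 0"
    proof
      fix j assume "j \<in> {..m + l} - {..m}"
      thus "(x choose (m + l - j)) * ((l choose j) * ((m + l - j) choose l)) = 0"
        by (cases "j \<le> l") (auto simp: binomial_eq_0)
    qed
  qed auto
  also have "\<dots> = (\<Sum>j\<le>m. (x choose l) * ((l choose j) * ((x - l) choose (m - j))))"
    using outer by (intro sum.cong) auto
  also have "\<dots> = (x choose l) * ((l + (x - l)) choose m)"
    by (simp only: sum_distrib_left[symmetric] vandermonde)
  also have "\<dots> = (x choose m) * (x choose l)"
    by (cases "l \<le> x") (auto simp: binomial_eq_0)
  finally show ?thesis .
qed

text \<open>The coefficient of \<open>x\<^sup>i y\<^sup>n\<^sup>-\<^sup>i\<close> in MacMahon's identity. One factor \<open>n choose i\<close> splits off,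
  and the rest is \<open>sum_choose_choose_choose_add\<close> with \<open>m = i\<close>, \<open>l = n - i\<close> and \<open>x = n\<close>.\<close>

lemma binomial_cube_eq_sum:
  assumes "i \<le> n"
  shows "(n choose i) ^ 3
    = (\<Sum>k\<le>n. (n choose i) * (i choose k) * ((n - i) choose k) * ((n + k) choose k))"
proof -
  have "(n choose i) ^ 2 = (n choose i) * (n choose (n - i))"
    using binomial_symmetric[OF assms] by (simp add: power2_eq_square)
  also have "\<dots> = (\<Sum>k\<le>n - i. (i choose k) * ((n - i) choose k) * ((n + k) choose n))"
    using sum_choose_choose_choose_add[where l = "n - i" and m = i and x = n] assms by simp
  also have "\<dots> = (\<Sum>k\<le>n. (i choose k) * ((n - i) choose k) * ((n + k) choose n))"
    by (rule sum.mono_neutral_left) (auto simp: binomial_eq_0)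
  also have "\<dots> = (\<Sum>k\<le>n. (i choose k) * ((n - i) choose k) * ((n + k) choose k))"
    using binomial_symmetric[of n "n + k" for k] by simp
  finally have "(n choose i) * (n choose i) ^ 2
      = (n choose i) * (\<Sum>k\<le>n. (i choose k) * ((n - i) choose k) * ((n + k) choose k))"
    by simp
  thus ?thesis
    by (simp add: power3_eq_cube power2_eq_square sum_distrib_left mult.assoc)
qed

text \<open>Both sides are multinomial coefficients: they count the partitions of an \<open>n\<close>-set into parts of
  sizes \<open>k\<close>, \<open>i - k\<close>, \<open>k\<close> and \<open>n - i - k\<close>.\<close>

lemma choose_choose_choose_eq:
  assumes "k \<le> i" "k \<le> n - i" "i \<le> n"
  shows "(n choose i) * (i choose k) * ((n - i) choose k)
    = (n choose k) * ((n - k) choose k) * ((n - 2 * k) choose (i - k))"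
proof -
  have s1: "(n - k) choose (i - k) = (n - k) choose (n - i)"
    using binomial_symmetric[of "i - k" "n - k"] assms by simp
  have s2: "(n - k - k) choose (n - i - k) = (n - 2 * k) choose (i - k)"
  proof -
    have "n - 2 * k - (i - k) = n - i - k" "n - k - k = n - 2 * k" using assms by auto
    thus ?thesis using binomial_symmetric[of "i - k" "n - 2 * k"] assms by simp
  qed
  have "(n choose i) * (i choose k) * ((n - i) choose k)
      = (n choose k) * (((n - k) choose (n - i)) * ((n - i) choose k))"
    using choose_mult[of k i n] assms s1 by simp
  also have "\<dots> = (n choose k) * (((n - k) choose k) * ((n - 2 * k) choose (i - k)))"
    using choose_mult[of k "n - i" "n - k"] assms s2 by simp
  finally show ?thesis by simp
qed

text \<open>The value \<open>2 cos (\<pi> j / 3) = x\<^sup>j + y\<^sup>j\<close> for the primitive sixth roots of unity \<open>x\<close> and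
  \<open>y = 1 / x\<close>. A table keeps all computations in the integers. Of the roots of unity only the
  relation \<open>x + y = 1\<close> matters, in the form \<open>twice_cos_third_pi_add\<close>, besides the period \<open>6\<close> and the
  symmetry under \<open>j \<mapsto> - j\<close>.\<close>

definition twice_cos_third_pi :: "int \<Rightarrow> int" where
  "twice_cos_third_pi j =
     (if j mod 6 = 0 then 2 else if j mod 6 = 1 \<or> j mod 6 = 5 then 1
      else if j mod 6 = 3 then - 2 else - 1)"

lemma twice_cos_third_pi_0: "twice_cos_third_pi 0 = 2"
  by (simp add: twice_cos_third_pi_def)

lemma mod_6_cases: "(j :: int) mod 6 \<in> {0, 1, 2, 3, 4, 5}"
  by (simp, presburger)

lemma twice_cos_third_pi_add:
  "twice_cos_third_pi (j - 1) + twice_cos_third_pi (j + 1) = twice_cos_third_pi j"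
proof -
  have "(j - 1) mod 6 = (j mod 6 - 1) mod 6" "(j + 1) mod 6 = (j mod 6 + 1) mod 6"
    by (simp_all add: mod_diff_left_eq mod_add_left_eq)
  thus ?thesis
    using mod_6_cases[of j] unfolding twice_cos_third_pi_def by (elim insertE) simp_all
qed

lemma twice_cos_third_pi_minus: "twice_cos_third_pi (- j) = twice_cos_third_pi j"
  using mod_6_cases[of j] by (auto simp: twice_cos_third_pi_def zmod_zminus1_eq_if)

text \<open>A number prime to \<open>6\<close> is \<open>1\<close> or \<open>- 1\<close> modulo \<open>6\<close>, so it fixes or exchanges the two primitive
  sixth roots of unity.\<close>

lemma twice_cos_third_pi_mult:
  assumes "coprime p (6 :: int)"
  shows "twice_cos_third_pi (p * j) = twice_cos_third_pi j"
proof -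
  have "\<not> 2 dvd p" "\<not> 3 dvd p"
    using assms coprime_common_divisor[of p 6 2] coprime_common_divisor[of p 6 3] by auto
  hence "p mod 6 = 1 \<or> p mod 6 = 5" by presburger
  moreover have "(p * j) mod 6 = (p mod 6) * j mod 6" by (simp add: mod_mult_left_eq)
  ultimately have "(p * j) mod 6 = j mod 6 \<or> (p * j) mod 6 = (5 * j) mod 6" by auto
  thus ?thesis
  proof
    assume "(p * j) mod 6 = (5 * j) mod 6"
    also have "(5 * j) mod 6 = (- j) mod 6" by presburger
    finally have "(p * j) mod 6 = (- j) mod 6" .
    hence "twice_cos_third_pi (p * j) = twice_cos_third_pi (- j)"
      by (simp add: twice_cos_third_pi_def)
    thus ?thesis by (simp add: twice_cos_third_pi_minus)
  qed (simp add: twice_cos_third_pi_def)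
qed

lemma sum_choose_Suc:
  fixes f :: "nat \<Rightarrow> int"
  shows "(\<Sum>i\<le>Suc N. of_nat (Suc N choose i) * f i)
    = (\<Sum>i\<le>N. of_nat (N choose i) * (f i + f (Suc i)))"
proof -
  have "(\<Sum>i\<le>Suc N. of_nat (Suc N choose i) * f i)
      = f 0 + (\<Sum>i\<le>N. of_nat (N choose i) * f (Suc i))
        + (\<Sum>i\<le>N. of_nat (N choose Suc i) * f (Suc i))"
    by (subst sum.atMost_Suc_shift) (simp add: algebra_simps sum.distrib)
  moreover have "f 0 + (\<Sum>i\<le>N. of_nat (N choose Suc i) * f (Suc i))
      = (\<Sum>i\<le>Suc N. of_nat (N choose i) * f i)"
    by (subst sum.atMost_Suc_shift) simp
  ultimately show ?thesis by (simp add: algebra_simps sum.distrib binomial_eq_0)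
qed

text \<open>The expansion of \<open>(x + y)\<^sup>N = 1\<close>, multiplied by \<open>x\<^sup>s\<close> and added to its conjugate.\<close>

lemma sum_choose_twice_cos_third_pi:
  "(\<Sum>i\<le>N. int (N choose i) * twice_cos_third_pi (s + 2 * int i - int N)) = twice_cos_third_pi s"
proof (induction N)
  case (Suc N)
  have "twice_cos_third_pi (s + 2 * int i - int (Suc N))
      + twice_cos_third_pi (s + 2 * int (Suc i) - int (Suc N))
      = twice_cos_third_pi (s + 2 * int i - int N)" for i
    using twice_cos_third_pi_add[of "s + 2 * int i - int N"] by (simp add: algebra_simps)
  thus ?case using Suc.IH by (simp only: sum_choose_Suc)
qed simp

text \<open>Each summand of \<open>a_seq n\<close> is multiplied by an expansion of \<open>(x + y)\<^sup>n\<^sup>-\<^sup>2\<^sup>k\<close>; collecting the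
  terms with the same weight gives a cube by \<open>binomial_cube_eq_sum\<close>.\<close>

lemma twice_a_seq_eq_sum_cubes:
  "2 * int (a_seq n) = (\<Sum>i\<le>n. int (n choose i) ^ 3 * twice_cos_third_pi (2 * int i - int n))"
proof -
  let ?c = "\<lambda>i. twice_cos_third_pi (2 * int i - int n)"
  define t where "t i k = int ((n choose i) * (i choose k) * ((n - i) choose k) * ((n + k) choose k))"
    for i k
  have row: "2 * int ((n choose k) * ((n - k) choose k) * ((n + k) choose k))
      = (\<Sum>i\<le>n. t i k * ?c i)" for k
  proof (cases "2 * k \<le> n")
    case True
    have "2 = (\<Sum>i\<le>n - 2 * k. int ((n - 2 * k) choose i) * ?c (i + k))"
      using sum_choose_twice_cos_third_pi[of "n - 2 * k" 0] True
      by (simp add: twice_cos_third_pi_0 of_nat_diff algebra_simps)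
    also have "\<dots> = (\<Sum>i\<in>{k..n - k}. int ((n - 2 * k) choose (i - k)) * ?c i)"
      using True by (intro sum.reindex_bij_witness[where i = "\<lambda>i. i - k" and j = "\<lambda>i. i + k"]) auto
    finally have "2 = (\<Sum>i\<in>{k..n - k}. int ((n - 2 * k) choose (i - k)) * ?c i)" .
    from arg_cong[OF this, of "\<lambda>x. int ((n choose k) * ((n - k) choose k) * ((n + k) choose k)) * x"]
    have "2 * int ((n choose k) * ((n - k) choose k) * ((n + k) choose k))
      = (\<Sum>i\<in>{k..n - k}. int ((n choose k) * ((n - k) choose k) * ((n + k) choose k))
          * (int ((n - 2 * k) choose (i - k)) * ?c i))"
      unfolding sum_distrib_left by (simp only: mult.commute)
    also have "\<dots> = (\<Sum>i\<in>{k..n - k}. t i k * ?c i)"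
    proof (intro sum.cong refl)
      fix i assume "i \<in> {k..n - k}"
      hence "k \<le> i" "k \<le> n - i" "i \<le> n" using True by auto
      thus "int ((n choose k) * ((n - k) choose k) * ((n + k) choose k))
          * (int ((n - 2 * k) choose (i - k)) * ?c i) = t i k * ?c i"
        unfolding t_def by (subst choose_choose_choose_eq) (auto simp: mult_ac)
    qed
    also have "\<dots> = (\<Sum>i\<le>n. t i k * ?c i)"
    proof (rule sum.mono_neutral_left)
      show "\<forall>i\<in>{..n} - {k..n - k}. t i k * ?c i = 0"
      proof
        fix i assume "i \<in> {..n} - {k..n - k}"
        hence "i < k \<or> n - i < k" by auto
        thus "t i k * ?c i = 0" by (auto simp: t_def binomial_eq_0)
      qed
    qed auto
    finally show ?thesis .
  next
    case False
    have "t i k = 0" if "i \<le> n" for i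
    proof -
      have "i < k \<or> n - i < k" using False that by auto
      thus ?thesis by (auto simp: t_def binomial_eq_0)
    qed
    moreover have "(n - k) choose k = 0" using False by (intro binomial_eq_0) auto
    ultimately show ?thesis by simp
  qed
  have "2 * int (a_seq n) = (\<Sum>k\<le>n. \<Sum>i\<le>n. t i k * ?c i)"
    unfolding a_seq_def row[symmetric] by (simp add: sum_distrib_left atLeast0AtMost)
  also have "\<dots> = (\<Sum>i\<le>n. \<Sum>k\<le>n. t i k * ?c i)" by (rule sum.swap)
  also have "\<dots> = (\<Sum>i\<le>n. int (n choose i) ^ 3 * ?c i)"
  proof (intro sum.cong refl)
    fix i assume "i \<in> {..n}"
    hence "int (n choose i) ^ 3 = (\<Sum>k\<le>n. t i k)"
      unfolding t_def of_nat_power[symmetric] of_nat_sum[symmetric]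
      by (subst binomial_cube_eq_sum) auto
    thus "(\<Sum>k\<le>n. t i k * ?c i) = int (n choose i) ^ 3 * ?c i" by (simp add: sum_distrib_right)
  qed
  finally show ?thesis .
qed

section \<open>Products over shifted residue systems\<close>

lemma prod_add_cong_linear:
  fixes g :: "'a \<Rightarrow> int"
  assumes "finite A"
  shows "[(\<Prod>r\<in>A. g r + y) = (\<Prod>r\<in>A. g r) + y * (\<Sum>r\<in>A. \<Prod>s\<in>A - {r}. g s)] (mod y\<^sup>2)"
  using assms
proof (induction A)
  case (insert a A)
  define P where "P = (\<Prod>r\<in>A. g r)"
  define S where "S = (\<Sum>r\<in>A. \<Prod>s\<in>A - {r}. g s)"
  have "(\<Prod>s\<in>insert a A - {r}. g s) = g a * (\<Prod>s\<in>A - {r}. g s)" if "r \<in> A" for r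
  proof -
    have "insert a A - {r} = insert a (A - {r})" using insert that by auto
    thus ?thesis using insert by simp
  qed
  hence S': "(\<Sum>r\<in>insert a A. \<Prod>s\<in>insert a A - {r}. g s) = P + g a * S"
    using insert unfolding P_def S_def by (simp add: sum_distrib_left)
  have "[(g a + y) * (\<Prod>r\<in>A. g r + y) = (g a + y) * (P + y * S)] (mod y\<^sup>2)"
    using insert.IH unfolding P_def S_def by (rule cong_scalar_left)
  also have "(g a + y) * (P + y * S) = g a * P + y * (P + g a * S) + y\<^sup>2 * S"
    by (simp add: algebra_simps power2_eq_square)
  also have "[\<dots> = g a * P + y * (P + g a * S)] (mod y\<^sup>2)"
    by (simp add: cong_iff_dvd_diff)
  finally show ?case unfolding S' using insert by (simp add: P_def)
qed simp

lemma bij_betw_double_mod_totatives: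
  assumes "q > 1" "odd q"
  shows "bij_betw (\<lambda>r. 2 * r mod q) (totatives q) (totatives q)"
proof -
  have c2: "coprime 2 q" using assms by simp
  have "inj_on (\<lambda>r. 2 * r mod q) (totatives q)"
  proof (rule inj_onI)
    fix r s assume rs: "r \<in> totatives q" "s \<in> totatives q" and eq: "2 * r mod q = 2 * s mod q"
    hence "[r = s] (mod q)" using cong_mult_lcancel_nat[OF c2] by (simp add: cong_def)
    moreover have "r < q" "s < q" using rs totatives_less assms by blast+
    ultimately show "r = s" by (simp add: cong_less_modulus_unique_nat)
  qed
  moreover have "(\<lambda>r. 2 * r mod q) ` totatives q \<subseteq> totatives q"
  proof safe
    fix r assume "r \<in> totatives q"
    hence "coprime (2 * r) q" using c2 by (simp add: in_totatives_iff)
    hence c: "coprime (2 * r mod q) q" using assms by simp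
    hence "2 * r mod q \<noteq> 0" using assms by (intro notI) simp
    thus "2 * r mod q \<in> totatives q"
      using c assms by (simp add: in_totatives_iff less_imp_le)
  qed
  ultimately show ?thesis by (simp add: bij_betw_def endo_inj_surj)
qed

lemma bij_betw_reflect_totatives:
  assumes "q > 1"
  shows "bij_betw (\<lambda>r. q - r) (totatives q) (totatives q)"
proof -
  have "q - r \<in> totatives q \<and> r < q" if "r \<in> totatives q" for r
  proof -
    have r: "r < q" using that assms totatives_less by blast
    have "coprime (q - r) q"
    proof (rule coprimeI)
      fix c assume c: "c dvd q - r" "c dvd q"
      hence "c dvd r" using dvd_diffD1[of c q r] r by simp
      thus "is_unit c" using c that coprime_common_divisor in_totatives_iff by blast
    qed
    thus ?thesis using r by (simp add: in_totatives_iff)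
  qed
  thus ?thesis by (intro bij_betw_byWitness[where f' = "\<lambda>r. q - r"])
      (simp_all add: less_imp_le image_subset_iff)
qed

text \<open>Modulo \<open>q\<close> the factor \<open>s * (q - s)\<close> is \<open>- s\<^sup>2\<close>, so this sum is, up to a unit, the sum of the
  inverse squares of the units modulo \<open>q\<close>. Doubling permutes the units and multiplies each factor by
  \<open>4\<close>; by Euler's theorem the sum \<open>S\<close> then satisfies \<open>4 S \<equiv> 4\<^sup>\<phi>\<^sup>(\<^sup>q\<^sup>) S \<equiv> S\<close>, and \<open>3\<close> is invertible.
  Omitting a factor instead of inverting it avoids modular inverses.\<close>

lemma dvd_sum_prod_totatives_reflect:
  assumes "q > 1" "coprime q 6"
  shows "int q dvd (\<Sum>r\<in>totatives q. \<Prod>s\<in>totatives q - {r}. int s * (int q - int s))"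
proof -
  let ?U = "totatives q" and ?\<sigma> = "\<lambda>r. 2 * r mod q"
  define g where "g s = int s * (int q - int s)" for s
  define S where "S = (\<Sum>r\<in>?U. \<Prod>s\<in>?U - {r}. g s)"
  have "\<not> 2 dvd q" "\<not> 3 dvd q"
    using assms coprime_common_divisor[of q 6 2] coprime_common_divisor[of q 6 3] by auto
  hence odd: "odd q" and "coprime 3 q" by (simp_all add: prime_imp_coprime)
  hence c3: "coprime 3 (int q)" using coprime_int_iff[of 3 q] by simp
  note bij = bij_betw_double_mod_totatives[OF \<open>q > 1\<close> odd]
  have g: "[g (?\<sigma> s) = 4 * g s] (mod int q)" for s
  proof -
    have sq: "[g t = - (int t)\<^sup>2] (mod int q)" for t
      by (simp add: g_def cong_iff_dvd_diff power2_eq_square algebra_simps)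
    have "[int (?\<sigma> s) = 2 * int s] (mod int q)"
      by (simp add: cong_def zmod_int)
    hence "[(int (?\<sigma> s))\<^sup>2 = (2 * int s)\<^sup>2] (mod int q)" by (rule cong_pow)
    hence "[- (int (?\<sigma> s))\<^sup>2 = - (2 * int s)\<^sup>2] (mod int q)"
      by (simp only: cong_minus_minus_iff)
    with sq[of "?\<sigma> s"] have "[g (?\<sigma> s) = - (2 * int s)\<^sup>2] (mod int q)" by (rule cong_trans)
    moreover have "- (2 * int s)\<^sup>2 = 4 * - (int s)\<^sup>2" by (simp add: power_mult_distrib)
    ultimately have "[g (?\<sigma> s) = 4 * - (int s)\<^sup>2] (mod int q)" by simp
    also have "[4 * - (int s)\<^sup>2 = 4 * g s] (mod int q)"
      by (rule cong_scalar_left) (rule cong_sym[OF sq])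
    finally show ?thesis .
  qed
  have "S = (\<Sum>r\<in>?U. \<Prod>s\<in>?U - {?\<sigma> r}. g s)"
    unfolding S_def by (rule sum.reindex_bij_betw[OF bij, symmetric])
  also have "\<dots> = (\<Sum>r\<in>?U. \<Prod>s\<in>?U - {r}. g (?\<sigma> s))"
  proof (intro sum.cong refl prod.reindex_bij_betw[symmetric])
    fix r assume r: "r \<in> ?U"
    show "bij_betw ?\<sigma> (?U - {r}) (?U - {?\<sigma> r})"
      using bij_betw_DiffI[OF bij, of "{r}" "{?\<sigma> r}"] r bij_betwE[OF bij] by simp
  qed
  also have "[\<dots> = (\<Sum>r\<in>?U. \<Prod>s\<in>?U - {r}. 4 * g s)] (mod int q)"
    by (intro cong_sum cong_prod g)
  also have "(\<Sum>r\<in>?U. \<Prod>s\<in>?U - {r}. 4 * g s) = 4 ^ (totient q - 1) * S"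
    by (simp add: S_def prod.distrib sum_distrib_left totient_def)
  finally have "[4 * S = 4 * (4 ^ (totient q - 1) * S)] (mod int q)"
    by (rule cong_scalar_left)
  also have "4 * (4 ^ (totient q - 1) * S) = 4 ^ totient q * S"
    using assms by (simp add: power_eq_if totient_gt_0_iff)
  also have "[4 ^ totient q * S = 1 * S] (mod int q)"
  proof (rule cong_scalar_right)
    have "coprime 4 q" using odd coprime_power_left_iff[of 2 2 q] by simp
    hence "[4 ^ totient q = 1] (mod q)" by (rule euler_theorem)
    thus "[4 ^ totient q = 1] (mod int q)" using cong_int_iff[of "4 ^ totient q" 1 q] by simp
  qed
  finally have "int q dvd 4 * S - 1 * S" unfolding cong_iff_dvd_diff .
  hence "int q dvd 3 * S" by simp
  hence "int q dvd S" using c3 by (simp add: coprime_dvd_mult_right_iff coprime_commute)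
  thus ?thesis by (simp add: S_def g_def)
qed

text \<open>Let \<open>F X\<close> be the product on the left. Pairing \<open>r\<close> with \<open>q - r\<close> turns \<open>(F X)\<^sup>2\<close> into a product of
  the factors \<open>r * (q - r) + X * (X + 1) * q\<^sup>2\<close>. The shift by a multiple of \<open>q\<^sup>2\<close> can be expanded to
  first order, and the linear term gains another factor \<open>q\<close> by \<open>dvd_sum_prod_totatives_reflect\<close>.
  Hence \<open>(F X)\<^sup>2\<close> does not depend on \<open>X\<close> modulo \<open>q\<^sup>3\<close>. Neither does \<open>F X\<close>, because
  \<open>F X + F 0 \<equiv> 2 * F 0\<close> modulo \<open>q\<close> is a unit.\<close>

lemma prod_shifted_totatives_cong:
  assumes "coprime q 6"
  shows "[(\<Prod>r\<in>totatives q. X * int q + int r) = (\<Prod>r\<in>totatives q. int r)] (mod int q ^ 3)"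
proof (cases "q > 1")
  case True
  let ?U = "totatives q"
  define F where "F X = (\<Prod>r\<in>?U. X * int q + int r)" for X
  define P where "P = (\<Prod>r\<in>?U. int r * (int q - int r))"
  have sq: "[F X ^ 2 = P] (mod int q ^ 3)" for X
  proof -
    define y where "y = X * (X + 1) * (int q)\<^sup>2"
    have "F X = (\<Prod>r\<in>?U. X * int q + int (q - r))"
      unfolding F_def
      by (rule prod.reindex_bij_betw[OF bij_betw_reflect_totatives[OF True], symmetric])
    also have "\<dots> = (\<Prod>r\<in>?U. X * int q + (int q - int r))"
      by (intro prod.cong) (auto simp: in_totatives_iff of_nat_diff)
    finally have "F X ^ 2 = (\<Prod>r\<in>?U. (X * int q + int r) * (X * int q + (int q - int r)))"
      unfolding power2_eq_square prod.distrib by (simp add: F_def)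
    also have "\<dots> = (\<Prod>r\<in>?U. int r * (int q - int r) + y)"
      unfolding y_def by (intro prod.cong) (auto simp: power2_eq_square algebra_simps)
    finally have eq: "F X ^ 2 = (\<Prod>r\<in>?U. int r * (int q - int r) + y)" .
    define S where "S = (\<Sum>r\<in>?U. \<Prod>s\<in>?U - {r}. int s * (int q - int s))"
    have "y\<^sup>2 = int q ^ 3 * (int q * (X * (X + 1))\<^sup>2)"
      by (simp add: y_def power2_eq_square power3_eq_cube)
    hence "[F X ^ 2 = P + y * S] (mod int q ^ 3)"
      using prod_add_cong_linear[of ?U "\<lambda>r. int r * (int q - int r)" y]
      unfolding eq P_def S_def by (auto intro: cong_dvd_modulus)
    also have "[P + y * S = P] (mod int q ^ 3)"
    proof -
      obtain z where "S = int q * z"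
        using dvd_sum_prod_totatives_reflect[OF True assms] unfolding S_def by blast
      hence "y * S = int q ^ 3 * (X * (X + 1) * z)"
        by (simp add: y_def power2_eq_square power3_eq_cube)
      thus ?thesis by (simp add: cong_iff_dvd_diff)
    qed
    finally show ?thesis .
  qed
  have "[F X ^ 2 = F 0 ^ 2] (mod int q ^ 3)" by (rule cong_trans[OF sq cong_sym[OF sq]])
  hence dvd: "int q ^ 3 dvd (F X + F 0) * (F X - F 0)"
    by (simp add: cong_iff_dvd_diff power2_eq_square algebra_simps)
  have "coprime 2 q" using assms coprime_divisors[of 2 6 q q] by (simp add: coprime_commute)
  hence "coprime 2 (int q)" using coprime_int_iff[of 2 q] by simp
  moreover have "coprime (F 0) (int q)"
    unfolding F_def by (rule prod_coprime_left) (simp add: in_totatives_iff)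
  ultimately have "coprime (2 * F 0) (int q)" by simp
  moreover have "[2 * F 0 = F X + F 0] (mod int q)"
  proof -
    have "[F X = F 0] (mod int q)"
      unfolding F_def by (intro cong_prod) (simp add: cong_iff_dvd_diff)
    hence "[F X + F 0 = F 0 + F 0] (mod int q)" by (intro cong_add cong_refl)
    thus ?thesis unfolding mult_2 by (rule cong_sym)
  qed
  ultimately have "coprime (F X + F 0) (int q)" by (rule cong_imp_coprime[rotated])
  hence "coprime (int q ^ 3) (F X + F 0)" by (simp add: coprime_commute)
  hence "int q ^ 3 dvd F X - F 0" using dvd coprime_dvd_mult_right_iff by blast
  thus ?thesis by (simp add: F_def cong_iff_dvd_diff)
next
  case False
  moreover have "q \<noteq> 0" using assms by (intro notI) simp
  ultimately have "q = 1" by linarith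
  thus ?thesis by simp
qed

section \<open>Binomial coefficients modulo prime powers\<close>

text \<open>The part of the factorial of \<open>q * m\<close> that is prime to \<open>q\<close>. For \<open>q = p\<close> prime it is, up to sign,
  Morita's \<open>p\<close>-adic gamma function at \<open>p * m + 1\<close>.\<close>

definition coprime_fact :: "nat \<Rightarrow> nat \<Rightarrow> nat" where
  "coprime_fact q m = (\<Prod>i\<in>{i\<in>{1..q * m}. coprime i q}. i)"

lemma coprime_fact_cong_power:
  assumes "coprime q 6"
  shows "[int (coprime_fact q m) = (\<Prod>r\<in>totatives q. int r) ^ m] (mod int q ^ 3)"
proof (induction m)
  case (Suc m)
  have "q \<noteq> 0" using assms by (intro notI) simp
  hence cop: "coprime (q * m + r) q \<longleftrightarrow> coprime r q" for r
    using coprime_mod_left_iff[of q "q * m + r"] coprime_mod_left_iff[of q r] by simp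
  have split: "{i\<in>{1..q * Suc m}. coprime i q}
      = {i\<in>{1..q * m}. coprime i q} \<union> (\<lambda>r. q * m + r) ` totatives q" (is "?A = ?B \<union> ?C")
  proof (intro equalityI subsetI)
    fix i assume i: "i \<in> ?A"
    show "i \<in> ?B \<union> ?C"
    proof (cases "i \<le> q * m")
      case False
      then obtain r where r: "i = q * m + r" "0 < r" using less_imp_add_positive[of "q * m" i] by auto
      hence "r \<in> totatives q" using i cop by (simp add: in_totatives_iff)
      thus ?thesis using r by blast
    qed (use i in auto)
  qed (auto simp: in_totatives_iff cop)
  have "coprime_fact q (Suc m) = coprime_fact q m * (\<Prod>r\<in>totatives q. q * m + r)"
    unfolding coprime_fact_def split
    by (subst prod.union_disjoint) (auto simp: in_totatives_iff prod.reindex)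
  hence "int (coprime_fact q (Suc m))
      = int (coprime_fact q m) * (\<Prod>r\<in>totatives q. int m * int q + int r)"
    by (simp add: mult.commute)
  also have "[\<dots> = (\<Prod>r\<in>totatives q. int r) ^ m * (\<Prod>r\<in>totatives q. int r)] (mod int q ^ 3)"
    using Suc.IH prod_shifted_totatives_cong[OF assms] by (rule cong_mult)
  finally show ?case by (simp add: mult.commute)
qed (simp add: coprime_fact_def)

lemma coprime_fact_coprime: "coprime (coprime_fact q m) q"
  by (auto simp: coprime_fact_def intro!: prod_coprime_left)

text \<open>Being prime to \<open>p\<close> and being prime to a positive power of \<open>p\<close> are the same, so a product over
  blocks of length \<open>p\<close> may be regrouped into longer blocks, which are congruent to a higher modulus.\<close>

lemma coprime_fact_prime_power:
  "coprime_fact p (p ^ s * m) = coprime_fact (p ^ Suc s) m"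
proof -
  have "coprime i (p ^ Suc s) \<longleftrightarrow> coprime i p" for i by auto
  thus ?thesis by (simp only: coprime_fact_def power_Suc mult.assoc)
qed

lemma fact_prime_mult:
  assumes "prime p"
  shows "fact (p * m) = p ^ m * fact m * coprime_fact p m"
proof -
  have p: "p > 0" using assms prime_gt_0_nat by blast
  have split: "{1..p * m} = {i\<in>{1..p * m}. coprime i p} \<union> (\<lambda>j. p * j) ` {1..m}" (is "_ = ?A \<union> ?B")
  proof (intro equalityI subsetI)
    fix i assume i: "i \<in> {1..p * m}"
    show "i \<in> ?A \<union> ?B"
    proof (cases "p dvd i")
      case True
      then obtain j where "i = p * j" by blast
      thus ?thesis using i p by auto
    next
      case False
      hence "coprime i p" using assms prime_imp_coprime coprime_commute by blast
      thus ?thesis using i by auto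
    qed
  qed (use p in auto)
  have disj: "?A \<inter> ?B = {}"
    using assms by (auto simp: coprime_commute)
  have "fact (p * m) = \<Prod>{1..p * m}" by (simp add: fact_prod)
  also have "\<dots> = coprime_fact p m * (\<Prod>i\<in>?B. i)"
    unfolding coprime_fact_def by (subst split, subst prod.union_disjoint) (use disj in auto)
  also have "(\<Prod>i\<in>?B. i) = (\<Prod>j\<in>{1..m}. p * j)"
    using p by (subst prod.reindex) (auto simp: inj_on_def)
  also have "\<dots> = p ^ m * fact m" by (simp add: prod.distrib fact_prod)
  finally show ?thesis by (simp add: mult_ac)
qed

lemma choose_prime_mult:
  assumes "prime p" "j \<le> n"
  shows "coprime_fact p j * coprime_fact p (n - j) * ((p * n) choose (p * j))
    = coprime_fact p n * (n choose j)"
proof -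
  have p: "p > 0" using assms prime_gt_0_nat by blast
  have pw: "p ^ j * p ^ (n - j) = p ^ n" using assms by (simp flip: power_add)
  let ?K = "p ^ n * (fact j * fact (n - j))"
  have "?K * (coprime_fact p j * coprime_fact p (n - j) * ((p * n) choose (p * j)))
      = fact (p * j) * fact (p * n - p * j) * ((p * n) choose (p * j))"
    unfolding fact_prime_mult[OF assms(1)] pw[symmetric] diff_mult_distrib2[symmetric]
    by (simp add: mult_ac)
  also have "\<dots> = fact (p * n)" using assms by (intro binomial_fact_lemma) simp
  also have "\<dots> = p ^ n * (fact j * fact (n - j) * (n choose j)) * coprime_fact p n"
    unfolding fact_prime_mult[OF assms(1)] using binomial_fact_lemma[OF assms(2)] by simp
  also have "\<dots> = ?K * (coprime_fact p n * (n choose j))" by (simp add: mult_ac)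
  finally show ?thesis using p by simp
qed

text \<open>This follows from \<open>j * (n choose j) = n * ((n - 1) choose (j - 1))\<close>. For \<open>s < v\<close> the
  premises say that \<open>s\<close> is the multiplicity of \<open>p\<close> in \<open>j\<close>; otherwise the claimed power is \<open>1\<close>.\<close>

lemma prime_power_dvd_choose:
  assumes "prime p" "p ^ v dvd n" "s < v \<Longrightarrow> \<not> p ^ Suc s dvd j" "p ^ s dvd j" "j > 0"
  shows "p ^ (v - s) dvd (n choose j)"
proof (cases "s < v \<and> n > 0")
  case True
  obtain a where a: "n = p ^ v * a" using assms by blast
  obtain b where b: "j = p ^ s * b" using assms by blast
  have p: "p > 0" using assms prime_gt_0_nat by blast
  have "\<not> p dvd b" using assms(3) True b by auto
  hence cop: "coprime (p ^ (v - s)) b" using assms(1) by (simp add: prime_imp_coprime)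
  have "j * (n choose j) = n * ((n - 1) choose (j - 1))"
    using times_binomial_minus1_eq[OF \<open>j > 0\<close>, of n] .
  moreover have "p ^ v = p ^ s * p ^ (v - s)" using True by (simp flip: power_add)
  ultimately have "p ^ s * (b * (n choose j)) = p ^ s * (p ^ (v - s) * (a * ((n - 1) choose (j - 1))))"
    using a b by (simp add: mult_ac)
  hence "b * (n choose j) = p ^ (v - s) * (a * ((n - 1) choose (j - 1)))" using p by simp
  hence "p ^ (v - s) dvd b * (n choose j)" by simp
  thus ?thesis using cop coprime_dvd_mult_right_iff by blast
next
  case False
  thus ?thesis using \<open>j > 0\<close> by (auto simp: binomial_eq_0)
qed

lemma prime_gt_3_coprime_6:
  assumes p: "prime p" "p > 3"
  shows "coprime p (6 :: nat)"
proof -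
  have "\<not> p dvd 6"
  proof
    assume "p dvd 6"
    hence "p dvd 2 * 3" by simp
    hence "p dvd 2 \<or> p dvd 3" using p prime_dvd_mult_iff by blast
    thus False using p by (auto dest: dvd_imp_le)
  qed
  thus ?thesis using p by (simp add: prime_imp_coprime)
qed

text \<open>By \<open>choose_prime_mult\<close> the two binomial coefficients differ by the factor
  \<open>G n / (G j * G (n - j))\<close>, where \<open>G\<close> is \<open>coprime_fact p\<close>. With \<open>n = p\<^sup>s * a\<close> and \<open>j = p\<^sup>s * b\<close>,
  these products have \<open>a\<close>, \<open>b\<close> and \<open>a - b\<close> blocks, all congruent modulo the cube of
  \<open>p\<^sup>s\<^sup>+\<^sup>1\<close>, so the factor is \<open>1\<close> to that modulus. A power of \<open>p\<close> dividing \<open>n choose j\<close>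
  sharpens the congruence further.\<close>

lemma choose_prime_mult_cong:
  assumes p: "prime p" "p > 3" and j: "j \<le> n" "p ^ s dvd n" "p ^ s dvd j" and d: "p ^ e dvd (n choose j)"
  shows "int (p ^ e * (p ^ Suc s) ^ 3) dvd int ((p * n) choose (p * j)) - int (n choose j)"
proof -
  define q where "q = p ^ Suc s"
  define G where "G m = int (coprime_fact p m)" for m
  have q6: "coprime q 6" unfolding q_def using prime_gt_3_coprime_6[OF p] by simp
  obtain a where a: "n = p ^ s * a" using j by blast
  obtain b where b: "j = p ^ s * b" using j by blast
  have p0: "p > 0" using p by simp
  have ba: "b \<le> a" using a b j p0 by simp
  have nj: "n - j = p ^ s * (a - b)" by (simp add: a b diff_mult_distrib2)
  note G = coprime_fact_cong_power[OF q6]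
  have "[int (coprime_fact q b) * int (coprime_fact q (a - b))
      = (\<Prod>r\<in>totatives q. int r) ^ b * (\<Prod>r\<in>totatives q. int r) ^ (a - b)] (mod int q ^ 3)"
    by (intro cong_mult G)
  also have "(\<Prod>r\<in>totatives q. int r) ^ b * (\<Prod>r\<in>totatives q. int r) ^ (a - b)
      = (\<Prod>r\<in>totatives q. int r) ^ a"
    using ba by (simp flip: power_add)
  also have "[\<dots> = int (coprime_fact q a)] (mod int q ^ 3)" by (rule cong_sym) (rule G)
  finally have "[int (coprime_fact q b) * int (coprime_fact q (a - b)) = int (coprime_fact q a)] (mod int q ^ 3)" .
  hence "[G n = G j * G (n - j)] (mod int q ^ 3)"
    unfolding G_def nj unfolding a b coprime_fact_prime_power q_def by (rule cong_sym)
  then obtain z where z: "G n - G j * G (n - j) = int q ^ 3 * z"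
    unfolding cong_iff_dvd_diff by blast
  obtain c where c: "n choose j = p ^ e * c" using d by blast
  have "G j * G (n - j) * int ((p * n) choose (p * j)) = G n * int (n choose j)"
    unfolding G_def using choose_prime_mult[OF p(1) j(1)] by (metis of_nat_mult)
  hence "G j * G (n - j) * (int ((p * n) choose (p * j)) - int (n choose j))
      = (G n - G j * G (n - j)) * int (n choose j)"
    by (simp add: algebra_simps)
  also have "\<dots> = int (p ^ e * q ^ 3) * (z * int c)" unfolding z c by simp
  finally have dv: "int (p ^ e * q ^ 3) dvd
      G j * G (n - j) * (int ((p * n) choose (p * j)) - int (n choose j))" by simp
  have "coprime (coprime_fact p m) (p ^ e * q ^ 3)" for m
    using coprime_fact_coprime[of p m] by (simp add: q_def)
  hence "coprime (int (p ^ e * q ^ 3)) (G j * G (n - j))"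
    unfolding G_def coprime_mult_right_iff coprime_int_iff by (simp add: coprime_commute)
  thus ?thesis using dv coprime_dvd_mult_right_iff unfolding q_def by blast
qed

text \<open>For \<open>j > 0\<close> let \<open>s\<close> be the smaller of \<open>v\<close> and the multiplicity of \<open>p\<close> in \<open>j\<close>. In
  \<open>A\<^sup>3 - B\<^sup>3 = (A - B) * (A\<^sup>2 + A * B + B\<^sup>2)\<close> the first factor has \<open>(v - s) + 3 * (s + 1)\<close> factors \<open>p\<close>
  and the second one \<open>2 * (v - s)\<close>, which makes \<open>3 * (v + 1)\<close>, whatever \<open>s\<close> is.\<close>

lemma choose_prime_mult_cube_cong:
  assumes p: "prime p" "p > 3" and j: "j \<le> n" and v: "p ^ v dvd n"
  shows "[int ((p * n) choose (p * j)) ^ 3 = int (n choose j) ^ 3] (mod int (p ^ Suc v) ^ 3)"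
proof (cases "j = 0")
  case False
  obtain s where s: "s \<le> v" "p ^ s dvd j" "s < v \<Longrightarrow> \<not> p ^ Suc s dvd j"
  proof (cases "p ^ v dvd j")
    case True
    thus ?thesis using that[of v] by simp
  next
    case ndvd: False
    let ?s = "multiplicity p j"
    have "\<not> is_unit p" using p by simp
    hence s: "p ^ k dvd j \<longleftrightarrow> k \<le> ?s" for k using False by (simp add: power_dvd_iff_le_multiplicity)
    hence "?s < v" using ndvd by simp
    moreover have "p ^ ?s dvd j" "\<not> p ^ Suc ?s dvd j" unfolding s by simp_all
    ultimately show ?thesis using that[of ?s] by simp
  qed
  let ?A = "int ((p * n) choose (p * j))" and ?B = "int (n choose j)" and ?d = "int p ^ (v - s)"
  have dn: "p ^ (v - s) dvd (n choose j)"
    using prime_power_dvd_choose[OF p(1) v s(3) s(2)] False by simp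
  have "p ^ s dvd n" by (rule dvd_trans[OF le_imp_power_dvd[OF s(1)] v])
  hence diff: "int (p ^ (v - s) * (p ^ Suc s) ^ 3) dvd ?A - ?B"
    using choose_prime_mult_cong[OF p j _ s(2) dn] by simp
  have dB: "?d dvd ?B" using dn unfolding of_nat_power[symmetric] int_dvd_int_iff .
  have "?d dvd int (p ^ (v - s) * (p ^ Suc s) ^ 3)" by simp
  hence "?d dvd ?A - ?B" using diff by (rule dvd_trans)
  from dvd_add[OF this dB] have dA: "?d dvd ?A" by simp
  have "int (p ^ (v - s) * (p ^ Suc s) ^ 3) * (?d * ?d) dvd (?A - ?B) * (?A * ?A + ?A * ?B + ?B * ?B)"
    by (rule mult_dvd_mono[OF diff]) (intro dvd_add mult_dvd_mono dA dB)
  moreover have "int (p ^ (v - s) * (p ^ Suc s) ^ 3) * (?d * ?d) = int (p ^ Suc v) ^ 3"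
  proof -
    have "p ^ Suc v = p ^ (v - s) * p ^ Suc s" using s(1) by (simp flip: power_add)
    from arg_cong[OF this, of int] have "int (p ^ Suc v) = ?d * int (p ^ Suc s)"
      by (simp only: of_nat_mult of_nat_power)
    thus ?thesis by (simp only: of_nat_mult of_nat_power power3_eq_cube mult_ac)
  qed
  moreover have "(?A - ?B) * (?A * ?A + ?A * ?B + ?B * ?B) = ?A ^ 3 - ?B ^ 3"
    by (simp add: power3_eq_cube algebra_simps)
  ultimately show ?thesis by (simp add: cong_iff_dvd_diff)
qed simp

section \<open>The supercongruence\<close>

lemma a_seq_prime_mult_cong:
  assumes p: "prime p" "p > 3" and v: "p ^ v dvd n"
  shows "[int (a_seq (p * n)) = int (a_seq n)] (mod int (p ^ Suc v) ^ 3)"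
proof -
  let ?M = "int (p ^ Suc v) ^ 3"
  let ?f = "\<lambda>n i. int (n choose i) ^ 3 * twice_cos_third_pi (2 * int i - int n)"
  have p0: "p > 0" using p by simp
  have cop: "coprime (int p) 6"
    using prime_gt_3_coprime_6[OF p] coprime_int_iff[of p 6] by simp
  have "[2 * int (a_seq (p * n)) = (\<Sum>i\<in>(\<lambda>j. p * j) ` {..n}. ?f (p * n) i)] (mod ?M)"
  proof -
    have "?M dvd ?f (p * n) i" if i: "i \<in> {..p * n} - (\<lambda>j. p * j) ` {..n}" for i
    proof -
      have "\<not> p dvd i"
      proof
        assume "p dvd i"
        then obtain j where "i = p * j" by blast
        thus False using i p0 by auto
      qed
      \<comment> \<open>the multiplicity of \<open>p\<close> in \<open>i\<close> is \<open>0\<close>\<close>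
      hence "p ^ (Suc v - 0) dvd ((p * n) choose i)"
        using v by (intro prime_power_dvd_choose[OF p(1)]) (auto intro: gr0I)
      thus ?thesis by (intro dvd_mult2 dvd_power_same) (simp only: int_dvd_int_iff diff_zero)
    qed
    hence "?M dvd (\<Sum>i\<in>{..p * n} - (\<lambda>j. p * j) ` {..n}. ?f (p * n) i)" by (rule dvd_sum)
    moreover have "(\<Sum>i\<le>p * n. ?f (p * n) i)
        = (\<Sum>i\<in>{..p * n} - (\<lambda>j. p * j) ` {..n}. ?f (p * n) i) + (\<Sum>i\<in>(\<lambda>j. p * j) ` {..n}. ?f (p * n) i)"
      by (rule sum.subset_diff) auto
    ultimately show ?thesis unfolding twice_a_seq_eq_sum_cubes by (simp add: cong_iff_dvd_diff)
  qed
  also have "(\<Sum>i\<in>(\<lambda>j. p * j) ` {..n}. ?f (p * n) i) = (\<Sum>j\<le>n. ?f (p * n) (p * j))"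
    using p0 by (subst sum.reindex) (auto simp: inj_on_def)
  also have "\<dots> = (\<Sum>j\<le>n. int ((p * n) choose (p * j)) ^ 3 * twice_cos_third_pi (2 * int j - int n))"
  proof (intro sum.cong refl)
    fix j
    have "2 * int (p * j) - int (p * n) = int p * (2 * int j - int n)" by (simp add: algebra_simps)
    thus "?f (p * n) (p * j)
        = int ((p * n) choose (p * j)) ^ 3 * twice_cos_third_pi (2 * int j - int n)"
      using twice_cos_third_pi_mult[OF cop] by simp
  qed
  also have "[\<dots> = (\<Sum>j\<le>n. ?f n j)] (mod ?M)"
    using choose_prime_mult_cube_cong[OF p _ v] by (intro cong_sum cong_scalar_right) auto
  also have "(\<Sum>j\<le>n. ?f n j) = 2 * int (a_seq n)" by (simp add: twice_a_seq_eq_sum_cubes)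
  finally have "[2 * int (a_seq (p * n)) = 2 * int (a_seq n)] (mod ?M)" .
  moreover have "coprime 2 ?M"
    using coprime_divisors[of 2 6 "int p" "int p"] cop by (simp add: coprime_commute)
  ultimately show ?thesis using cong_mult_lcancel by blast
qed

lemma padic_of_rat_divide_in_ints:
  assumes "prime p" "m \<noteq> 0" "\<not> int p dvd m"
  shows "padic_of_rat p (of_int z / of_int m) \<in> padic_ints p"
proof -
  obtain c d where q: "quotient_of (of_int z / of_int m) = (c, d)" by fastforce
  have d: "d > 0" and cop: "coprime c d" using q quotient_of_denom_pos quotient_of_coprime by blast+
  have "(of_int z / of_int m :: rat) = of_int c / of_int d" using q quotient_of_div by blast
  hence "(of_int (c * m) :: rat) = of_int (z * d)" using d assms by (simp add: field_simps)
  hence eq: "c * m = z * d" by (simp only: of_int_eq_iff)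
  have "d dvd c * m" unfolding eq by simp
  hence "d dvd m" using cop coprime_dvd_mult_right_iff coprime_commute by blast
  hence "\<not> int p dvd d" using assms dvd_trans by blast
  thus ?thesis using q assms by (simp add: padic_of_rat_in_ints_iff)
qed

theorem theorem1p2:
  fixes p n :: nat
  assumes "prime p" and "p > 3" and "n > 0"
  shows "padic_of_rat p ((of_nat (a_seq (p * n)) - of_nat (a_seq n)) / (of_nat (p * n)) ^ 3)
           \<in> padic_ints p"
proof -
  obtain m where m: "n = p ^ multiplicity p n * m" "\<not> p dvd m"
    using multiplicity_decompose'[of n p] assms by (auto simp: mult.commute)
  define q where "q = p ^ Suc (multiplicity p n)"
  have pn: "p * n = q * m" using m(1) by (simp add: q_def)
  have "q > 0" "m > 0" using assms pn by (auto simp: q_def intro: gr0I)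
  obtain z where z: "int (a_seq (p * n)) - int (a_seq n) = int q ^ 3 * z"
    using a_seq_prime_mult_cong[OF assms(1,2) multiplicity_dvd[of p n]]
    unfolding q_def cong_iff_dvd_diff by blast
  have "(of_nat (a_seq (p * n)) - of_nat (a_seq n) :: rat) = of_int (int q ^ 3 * z)"
    unfolding z[symmetric] by simp
  hence "(of_nat (a_seq (p * n)) - of_nat (a_seq n)) / (of_nat (p * n)) ^ 3
      = (of_int z / of_int (int m ^ 3) :: rat)"
    unfolding pn using \<open>q > 0\<close> by (simp add: power_mult_distrib)
  moreover have "\<not> int p dvd int m ^ 3"
    using assms(1) m(2) prime_dvd_power[of p m 3] by (metis int_dvd_int_iff of_nat_power)
  ultimately show ?thesis
    using padic_of_rat_divide_in_ints[OF assms(1), of "int m ^ 3" z] \<open>m > 0\<close> by simp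
qed

end
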